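(* There exists a pair of commuting contractive (square, complex) matrices $X,Y$ with $X^3=Y^2$, but such that the unital bounded representation $\pi$ of $\mathscr{A}$ determined by $\pi(z^2)=X$, $\pi(z^3)=Y$ (exists and) is not contractive.
   Context: $\mathbb D$ is the open unit disk in $\mathbb C$. The disk algebra $\mathbb A(\mathbb D)$ is the closure of the analytic polynomials in $C(\overline{\mathbb D})$ with the supremum norm. The Neil algebra is $\mathscr{A}=\{f\in\mathbb A(\mathbb D): f'(0)=0\}=\mathbb C+z^2\mathbb A(\mathbb D)$, with the supremum norm; it is generated as a unital Banach algebra by $z^2$ and $z^3$, so a bounded unital representation is determined by its values on $z^2$ and $z^3$. A matrix is contractive if its operator norm is at most one. A representation $\pi$ of $\mathscr{A}$ is contractive if $\|\pi(f)\|\le\|f\|$ for all $f\in\mathscr{A}$. *)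

theory Defs
  imports
    "HOL-Analysis.Analysis"
    "HOL-Computational_Algebra.Polynomial"
    "Jordan_Normal_Form.Matrix"
begin

text \<open>
  A function on the closed unit disk is represented by a function on the complex plane that is
  extensional on the disk, as in \<^const>\<open>cfunspace\<close>, so that equality of functions
  is equality on the disk. The algebra operations are pointwise, followed by this restriction.
\<close>

abbreviation on_disk :: "(complex \<Rightarrow> complex) \<Rightarrow> complex \<Rightarrow> complex" where
  "on_disk f \<equiv> restrict f (cball 0 1)"

text \<open>The metric of \<^const>\<open>cfunspace\<close> is the supremum metric.\<close>

definition disk_algebra :: "(complex \<Rightarrow> complex) set" where
  "disk_algebra =
     mtopology_of (cfunspace (top_of_set (cball 0 1)) euclidean_metric)
       closure_of (range (\<lambda>p. on_disk (poly p)))"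

definition sup_norm :: "(complex \<Rightarrow> complex) \<Rightarrow> real" where
  "sup_norm f = (SUP z\<in>cball 0 1. cmod (f z))"

definition neil_algebra :: "(complex \<Rightarrow> complex) set" where
  "neil_algebra = {f \<in> disk_algebra. deriv f 0 = 0}"

definition euclid_norm :: "complex Matrix.vec \<Rightarrow> real" where
  "euclid_norm v = L2_set (\<lambda>i. cmod (vec_index v i)) {..<dim_vec v}"

definition op_norm :: "complex Matrix.mat \<Rightarrow> real" where
  "op_norm A = (SUP v\<in>{v \<in> carrier_vec (dim_col A). euclid_norm v \<le> 1}. euclid_norm (A *\<^sub>v v))"

definition contractive_mat :: "complex Matrix.mat \<Rightarrow> bool" where
  "contractive_mat A \<longleftrightarrow> op_norm A \<le> 1"

text \<open>
  Unital bounded representations of the Neil algebra on \<open>n \<times> n\<close> matrices; values outside the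
  algebra are irrelevant.
\<close>

definition bounded_unital_rep ::
  "nat \<Rightarrow> ((complex \<Rightarrow> complex) \<Rightarrow> complex Matrix.mat) \<Rightarrow> bool" where
  "bounded_unital_rep n \<pi> \<longleftrightarrow>
     (\<forall>f\<in>neil_algebra. \<pi> f \<in> carrier_mat n n) \<and>
     (\<forall>f\<in>neil_algebra. \<forall>g\<in>neil_algebra. \<pi> (on_disk (\<lambda>z. f z + g z)) = \<pi> f + \<pi> g) \<and>
     (\<forall>c. \<forall>f\<in>neil_algebra. \<pi> (on_disk (\<lambda>z. c * f z)) = c \<cdot>\<^sub>m \<pi> f) \<and>
     (\<forall>f\<in>neil_algebra. \<forall>g\<in>neil_algebra. \<pi> (on_disk (\<lambda>z. f z * g z)) = \<pi> f * \<pi> g) \<and>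
     \<pi> (on_disk (\<lambda>z. 1)) = 1\<^sub>m n \<and>
     (\<exists>C. \<forall>f\<in>neil_algebra. op_norm (\<pi> f) \<le> C * sup_norm f)"

definition contractive_rep :: "((complex \<Rightarrow> complex) \<Rightarrow> complex Matrix.mat) \<Rightarrow> bool" where
  "contractive_rep \<pi> \<longleftrightarrow> (\<forall>f\<in>neil_algebra. op_norm (\<pi> f) \<le> sup_norm f)"

end

theory Submission
  imports Defs "HOL-Complex_Analysis.Cauchy_Integral_Formula"
begin

text \<open>
  Let \<open>E\<close> be the \<open>2 \<times> 2\<close> matrix unit in the upper right corner and take
  \<open>X = Y = E\<close>. This is a contraction with \<open>E\<^sup>2 = 0\<close>, so \<open>X\<^sup>3 = Y\<^sup>2\<close>.
  All monomials \<open>z\<^sup>k\<close> with \<open>k \<ge> 4\<close> are products of at least two of the generators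
  \<open>z\<^sup>2\<close>, \<open>z\<^sup>3\<close> and must be sent to \<open>0\<close>, so with \<open>f = \<Sum>k. a\<^sub>k z\<^sup>k\<close> and
  \<open>a\<^sub>1 = 0\<close> the representation is
  \<open>\<pi> f = a\<^sub>0 I + (a\<^sub>2 + a\<^sub>3) E\<close>. It is bounded by Cauchy's estimate
  (\<open>norm_taylor_coeff_le\<close>), and multiplicative because, when the coefficients of \<open>z\<close> vanish,
  the functionals \<open>a\<^sub>2\<close> and \<open>a\<^sub>3\<close> are both derivations at \<open>0\<close>.

  The point is that \<open>a\<^sub>2\<close> and \<open>a\<^sub>3\<close> each have norm at most one, but their sum does not.
  Writing \<open>f = z\<^sup>2 g\<close>, one asks how large \<open>g 0 + g' 0\<close> can be when
  \<open>\<bar>g\<bar> \<le> 1\<close> on the disk; the Schwarz-Pick bound \<open>\<bar>g' 0\<bar> \<le> 1 - \<bar>g 0\<bar>\<^sup>2\<close> leaves room for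
  the value \<open>5/4\<close>, and a disk automorphism attains it. A polynomial suffices to exceed one:
  \<open>g = 2 + 2 z - z\<^sup>2\<close> has \<open>g 0 + g' 0 = 4\<close> while
  \<open>\<bar>g\<bar>\<^sup>2 \<le> 27/2 < 16\<close> (\<open>norm_quadratic_le\<close>).

  That the images of \<open>z\<^sup>2\<close> and \<open>z\<^sup>3\<close> determine a bounded representation
  (\<open>bounded_unital_rep_unique\<close>) is a density argument: the polynomials without linear term are
  spanned by \<open>1\<close> and products of generators, and they are dense in the Neil algebra
  (\<open>neil_algebra_approx\<close>).
\<close>

section \<open>The operator norm of a matrix\<close>

lemma norm_component_le_euclid_norm:
  assumes "i < dim_vec v"
  shows "cmod (vec_index v i) \<le> euclid_norm v"
  unfolding euclid_norm_def
  by (rule member_le_L2_set) (use assms in auto)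

text \<open>The operator norm is defined as a supremum, which says something only once the set is known to
  be bounded. This crude bound supplies that, and also serves as the upper estimate in the proof
  that the example is a bounded representation.\<close>

lemma euclid_norm_mult_mat_vec_le_sum:
  assumes v: "v \<in> carrier_vec (dim_col A)" "euclid_norm v \<le> 1"
  shows "euclid_norm (A *\<^sub>v v) \<le> (\<Sum>i<dim_row A. \<Sum>j<dim_col A. cmod (A $$ (i, j)))"
proof -
  have "euclid_norm (A *\<^sub>v v) \<le> (\<Sum>i<dim_row A. cmod (vec_index (A *\<^sub>v v) i))"
    unfolding euclid_norm_def dim_mult_mat_vec by (rule L2_set_le_sum) simp
  also have "\<dots> \<le> (\<Sum>i<dim_row A. \<Sum>j<dim_col A. cmod (A $$ (i, j)))"
  proof (rule sum_mono)
    fix i assume i: "i \<in> {..<dim_row A}"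
    have "cmod (vec_index (A *\<^sub>v v) i) = cmod (\<Sum>j<dim_col A. A $$ (i, j) * vec_index v j)"
      using i v by (simp add: scalar_prod_def atLeast0LessThan)
    also have "\<dots> \<le> (\<Sum>j<dim_col A. cmod (A $$ (i, j)) * cmod (vec_index v j))"
      by (rule order_trans[OF norm_sum]) (simp add: norm_mult)
    also have "\<dots> \<le> (\<Sum>j<dim_col A. cmod (A $$ (i, j)))"
    proof (rule sum_mono)
      fix j assume "j \<in> {..<dim_col A}"
      then have "j < dim_vec v" using carrier_vecD[OF v(1)] by simp
      from order_trans[OF norm_component_le_euclid_norm[OF this] v(2)]
      have "cmod (vec_index v j) \<le> 1" .
      then show "cmod (A $$ (i, j)) * cmod (vec_index v j) \<le> cmod (A $$ (i, j))"
        by (simp add: mult_left_le)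
    qed
    finally show "cmod (vec_index (A *\<^sub>v v) i) \<le> (\<Sum>j<dim_col A. cmod (A $$ (i, j)))" .
  qed
  finally show ?thesis .
qed

lemma euclid_norm_zero_vec [simp]: "euclid_norm (0\<^sub>v n) = 0"
  by (simp add: euclid_norm_def L2_set_def)

lemma op_norm_leI:
  assumes "\<And>v. v \<in> carrier_vec (dim_col A) \<Longrightarrow> euclid_norm v \<le> 1 \<Longrightarrow> euclid_norm (A *\<^sub>v v) \<le> B"
  shows "op_norm A \<le> B"
  unfolding op_norm_def
proof (rule cSUP_least)
  have "0\<^sub>v (dim_col A) \<in> {v \<in> carrier_vec (dim_col A). euclid_norm v \<le> 1}" by simp
  then show "{v \<in> carrier_vec (dim_col A). euclid_norm v \<le> 1} \<noteq> {}" by blast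
qed (use assms in auto)

lemma op_norm_le_sum: "op_norm A \<le> (\<Sum>i<dim_row A. \<Sum>j<dim_col A. cmod (A $$ (i, j)))"
  by (intro op_norm_leI euclid_norm_mult_mat_vec_le_sum)

text \<open>Evaluating at a standard basis vector gives a column of the matrix. Lower bounds on operator
  norms and entrywise convergence both come from this.\<close>

lemma norm_entry_le_op_norm:
  assumes ij: "i < dim_row A" "j < dim_col A"
  shows "cmod (A $$ (i, j)) \<le> op_norm A"
proof -
  let ?e = "unit_vec (dim_col A) j :: complex Matrix.vec"
  have e: "euclid_norm ?e \<le> 1"
  proof -
    have "(\<Sum>i<dim_col A. (cmod (vec_index ?e i))\<^sup>2) = (\<Sum>i<dim_col A. if i = j then 1 else 0)"
      by (intro sum.cong) (auto simp: unit_vec_def)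
    also have "\<dots> = 1" using ij by simp
    finally show ?thesis by (simp add: euclid_norm_def L2_set_def)
  qed
  have "A *\<^sub>v ?e = col A j"
    using ij by (intro eq_vecI) (auto simp: scalar_prod_right_unit[of _ "dim_col A"])
  then have "cmod (A $$ (i, j)) = cmod (vec_index (A *\<^sub>v ?e) i)"
    using ij by simp
  also have "\<dots> \<le> euclid_norm (A *\<^sub>v ?e)"
    using ij by (intro norm_component_le_euclid_norm) simp
  also have "\<dots> \<le> op_norm A"
    unfolding op_norm_def
  proof (rule cSUP_upper)
    show "bdd_above ((\<lambda>v. euclid_norm (A *\<^sub>v v)) ` {v \<in> carrier_vec (dim_col A). euclid_norm v \<le> 1})"
      using euclid_norm_mult_mat_vec_le_sum by (intro bdd_aboveI2) blast
  qed (use e in auto)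
  finally show ?thesis .
qed

section \<open>The disk algebra\<close>

lemma mspace_continuous_functions_on_disk:
  "mspace (cfunspace (top_of_set (cball 0 1)) euclidean_metric) =
     {f :: complex \<Rightarrow> complex. f \<in> extensional (cball 0 1) \<and> continuous_on (cball 0 1) f}"
  by (subst compactin_mspace_cfunspace)
     (auto simp: compactin_subtopology mtopology_of_euclidean)

lemma continuous_on_on_disk:
  "continuous_on (cball 0 1) f \<Longrightarrow> continuous_on (cball 0 1) (on_disk f)"
  by (rule continuous_on_eq) auto

lemma on_disk_poly_in_mspace:
  "on_disk (poly p) \<in> mspace (cfunspace (top_of_set (cball 0 1)) euclidean_metric)"
  unfolding mspace_continuous_functions_on_disk
  by (intro CollectI conjI restrict_extensional continuous_on_on_disk continuous_intros)

text \<open>The topological closure in the space of continuous functions, unfolded to uniform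
  approximability by polynomials.\<close>

lemma disk_algebra_iff:
  "f \<in> disk_algebra \<longleftrightarrow>
     f \<in> extensional (cball 0 1) \<and> continuous_on (cball 0 1) f \<and>
     (\<forall>e>0. \<exists>p. \<forall>z\<in>cball 0 1. cmod (f z - poly p z) \<le> e)"
proof -
  let ?m = "cfunspace (top_of_set (cball 0 1)) euclidean_metric :: (complex \<Rightarrow> complex) metric"
  interpret M: Metric_space "mspace ?m" "mdist ?m" by (rule Metric_space_mspace_mdist)
  have dist: "mdist ?m f (on_disk (poly p)) \<le> e \<longleftrightarrow> (\<forall>z\<in>cball 0 1. cmod (f z - poly p z) \<le> e)"
    if "f \<in> mspace ?m" for p e
    using cfunspace_mdist_le[OF that on_disk_poly_in_mspace[of p], of e]
    by (simp add: dist_norm)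
  have "disk_algebra = {f \<in> mspace ?m. \<forall>r>0. \<exists>g\<in>range (\<lambda>p. on_disk (poly p)). g \<in> M.mcball f r}"
    unfolding disk_algebra_def mtopology_of_def by (rule M.metric_closure_of_alt)
  also have "f \<in> \<dots> \<longleftrightarrow> f \<in> mspace ?m \<and> (\<forall>e>0. \<exists>p. mdist ?m f (on_disk (poly p)) \<le> e)"
    using on_disk_poly_in_mspace by (auto simp del: mspace_cfunspace)
  also have "\<dots> \<longleftrightarrow> f \<in> mspace ?m \<and> (\<forall>e>0. \<exists>p. \<forall>z\<in>cball 0 1. cmod (f z - poly p z) \<le> e)"
    using dist by (auto simp del: mspace_cfunspace)
  finally show ?thesis
    by (simp only: mspace_continuous_functions_on_disk mem_Collect_eq conj_assoc)
qed

lemma disk_algebra_continuous_on: "f \<in> disk_algebra \<Longrightarrow> continuous_on (cball 0 1) f"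
  by (simp add: disk_algebra_iff)

lemma disk_algebra_extensional: "f \<in> disk_algebra \<Longrightarrow> f \<in> extensional (cball 0 1)"
  by (simp add: disk_algebra_iff)

lemma disk_algebra_approx:
  assumes "f \<in> disk_algebra" "e > 0"
  obtains p where "\<And>z. z \<in> cball 0 1 \<Longrightarrow> cmod (f z - poly p z) \<le> e"
  using assms unfolding disk_algebra_iff by blast

lemma disk_algebra_holomorphic:
  assumes "f \<in> disk_algebra"
  shows "f holomorphic_on ball 0 1"
proof -
  have "\<exists>p. \<forall>z\<in>cball 0 1. cmod (f z - poly p z) \<le> 1 / real (Suc n)" for n
    using disk_algebra_approx[OF assms, of "1 / real (Suc n)"] by (metis of_nat_0_less_iff zero_less_Suc zero_less_divide_1_iff)
  then obtain p where p: "\<And>n z. z \<in> cball 0 1 \<Longrightarrow> cmod (f z - poly (p n) z) \<le> 1 / real (Suc n)"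
    by metis
  have "uniform_limit (cball 0 1) (\<lambda>n. poly (p n)) f sequentially"
  proof (rule uniform_limitI)
    fix e :: real assume "e > 0"
    have "eventually (\<lambda>n. 1 / real (Suc n) < e) sequentially"
      by (rule order_tendstoD(2)[OF LIMSEQ_Suc[OF lim_1_over_n] \<open>e > 0\<close>])
    then show "\<forall>\<^sub>F n in sequentially. \<forall>z\<in>cball 0 1. dist (poly (p n) z) (f z) < e"
    proof eventually_elim
      case (elim n)
      then show ?case
        using p[of _ n] by (force simp: dist_norm norm_minus_commute)
    qed
  qed
  then show ?thesis
    by (rule holomorphic_uniform_limit[rotated])
       (auto intro!: always_eventually continuous_intros holomorphic_intros)
qed

lemma on_disk_poly_in_disk_algebra: "on_disk (poly p) \<in> disk_algebra"
  unfolding disk_algebra_iff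
  by (intro conjI allI impI exI[of _ p] restrict_extensional continuous_on_on_disk continuous_intros) simp

lemma disk_algebra_diff_poly:
  assumes f: "f \<in> disk_algebra"
  shows "on_disk (\<lambda>z. f z - poly q z) \<in> disk_algebra"
  unfolding disk_algebra_iff
proof (intro conjI allI impI)
  show "continuous_on (cball 0 1) (on_disk (\<lambda>z. f z - poly q z))"
    by (intro continuous_on_on_disk continuous_intros disk_algebra_continuous_on f)
  fix e :: real assume "e > 0"
  then obtain p where "\<And>z. z \<in> cball 0 1 \<Longrightarrow> cmod (f z - poly p z) \<le> e"
    using disk_algebra_approx[OF f] by blast
  then show "\<exists>p. \<forall>z\<in>cball 0 1. cmod (on_disk (\<lambda>z. f z - poly q z) z - poly p z) \<le> e"
    by (intro exI[of _ "p - q"]) simp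
qed (rule restrict_extensional)

lemma sup_norm_leI:
  assumes "\<And>z. z \<in> cball 0 1 \<Longrightarrow> cmod (f z) \<le> B"
  shows "sup_norm f \<le> B"
  unfolding sup_norm_def by (rule cSUP_least) (use assms in auto)

lemma norm_le_sup_norm:
  assumes "f \<in> disk_algebra" "z \<in> cball 0 1"
  shows "cmod (f z) \<le> sup_norm f"
  unfolding sup_norm_def
proof (rule cSUP_upper)
  have "compact ((\<lambda>z. cmod (f z)) ` cball 0 1)"
    by (intro compact_continuous_image continuous_intros disk_algebra_continuous_on assms) auto
  then show "bdd_above ((\<lambda>z. cmod (f z)) ` cball 0 1)"
    by (intro bounded_imp_bdd_above compact_imp_bounded)
qed (use assms in auto)

section \<open>Taylor coefficients at the origin\<close>

definition taylor_coeff :: "nat \<Rightarrow> (complex \<Rightarrow> complex) \<Rightarrow> complex" where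
  "taylor_coeff k f = (deriv ^^ k) f 0 / fact k"

text \<open>Extending a function by a default value outside the closed disk is invisible to derivatives at
  the origin.\<close>

lemma taylor_coeff_on_disk:
  assumes "f holomorphic_on ball 0 1"
  shows "taylor_coeff k (on_disk f) = taylor_coeff k f"
proof -
  have "on_disk f holomorphic_on ball 0 1"
    using assms by (rule holomorphic_transform) auto
  then show ?thesis
    unfolding taylor_coeff_def
    using higher_deriv_transform_within_open[of "on_disk f" "ball 0 1" f 0 k] assms by simp
qed

lemma taylor_coeff_add:
  assumes "f holomorphic_on ball 0 1" "g holomorphic_on ball 0 1"
  shows "taylor_coeff k (on_disk (\<lambda>z. f z + g z)) = taylor_coeff k f + taylor_coeff k g"
  using assms
  by (subst taylor_coeff_on_disk)
     (auto simp: taylor_coeff_def higher_deriv_add[of _ "ball 0 1"] add_divide_distrib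
           intro!: holomorphic_intros)

lemma taylor_coeff_cmult:
  assumes "f holomorphic_on ball 0 1"
  shows "taylor_coeff k (on_disk (\<lambda>z. c * f z)) = c * taylor_coeff k f"
  using assms
  by (subst taylor_coeff_on_disk)
     (auto simp: taylor_coeff_def higher_deriv_cmult[of _ "ball 0 1"] intro!: holomorphic_intros)

lemma taylor_coeff_mult:
  assumes "f holomorphic_on ball 0 1" "g holomorphic_on ball 0 1"
  shows "taylor_coeff k (on_disk (\<lambda>z. f z * g z)) =
           (\<Sum>i\<le>k. taylor_coeff i f * taylor_coeff (k - i) g)"
proof -
  have "taylor_coeff k (on_disk (\<lambda>z. f z * g z)) =
          (\<Sum>i=0..k. of_nat (k choose i) * (deriv ^^ i) f 0 * (deriv ^^ (k - i)) g 0) / fact k"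
    using assms
    by (subst taylor_coeff_on_disk)
       (auto simp: taylor_coeff_def higher_deriv_mult[of _ "ball 0 1"] intro!: holomorphic_intros)
  also have "\<dots> = (\<Sum>i\<le>k. taylor_coeff i f * taylor_coeff (k - i) g)"
    unfolding sum_divide_distrib atLeast0AtMost taylor_coeff_def
    by (intro sum.cong) (simp_all add: binomial_fact)
  finally show ?thesis .
qed

lemma taylor_coeff_poly: "taylor_coeff k (on_disk (poly p)) = coeff p k"
proof -
  have "(deriv ^^ k) (poly p) = poly ((pderiv ^^ k) p)"
    by (induction k) (auto intro!: DERIV_imp_deriv poly_DERIV)
  then have "taylor_coeff k (poly p) = coeff ((pderiv ^^ k) p) 0 / fact k"
    by (simp add: taylor_coeff_def poly_0_coeff_0)
  also have "\<dots> = coeff p k"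
    by (simp add: coeff_higher_pderiv pochhammer_fact[symmetric])
  finally show ?thesis
    by (subst taylor_coeff_on_disk) (auto intro!: holomorphic_intros)
qed

lemma taylor_coeff_diff_poly:
  assumes "f \<in> disk_algebra"
  shows "taylor_coeff k (on_disk (\<lambda>z. f z - poly p z)) = taylor_coeff k f - coeff p k"
proof -
  have "on_disk (\<lambda>z. f z - poly p z) = on_disk (\<lambda>z. f z + on_disk (poly (- p)) z)"
    by (auto simp: restrict_def)
  then have "taylor_coeff k (on_disk (\<lambda>z. f z - poly p z)) =
               taylor_coeff k f + taylor_coeff k (on_disk (poly (- p)))"
    by (simp only:) (intro taylor_coeff_add disk_algebra_holomorphic assms on_disk_poly_in_disk_algebra)
  then show ?thesis by (simp only: taylor_coeff_poly) simp
qed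

text \<open>Cauchy's estimate on the unit circle itself: the Taylor coefficients are functionals of
  norm at most one for the supremum norm. This makes the example bounded, and it lets the
  vanishing linear coefficient of a limit control those of its approximants.\<close>

lemma norm_taylor_coeff_le:
  assumes f: "f \<in> disk_algebra" and B: "\<And>z. z \<in> cball 0 1 \<Longrightarrow> cmod (f z) \<le> B"
  shows "cmod (taylor_coeff k f) \<le> B"
proof -
  have "cmod ((deriv ^^ k) f 0) \<le> fact k * B / 1 ^ k"
    by (rule Cauchy_inequality)
       (use B in \<open>auto intro!: disk_algebra_holomorphic disk_algebra_continuous_on f\<close>)
  then show ?thesis
    by (simp add: taylor_coeff_def norm_divide divide_simps mult.commute)
qed

section \<open>The Neil algebra\<close>

lemma neil_algebra_iff: "f \<in> neil_algebra \<longleftrightarrow> f \<in> disk_algebra \<and> taylor_coeff 1 f = 0"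
  by (simp add: neil_algebra_def taylor_coeff_def)

lemma on_disk_poly_in_neil_algebra: "on_disk (poly p) \<in> neil_algebra \<longleftrightarrow> coeff p 1 = 0"
  by (simp add: neil_algebra_iff on_disk_poly_in_disk_algebra taylor_coeff_poly del: One_nat_def)

lemma on_disk_power_in_neil_algebra:
  assumes "k \<noteq> 1"
  shows "on_disk (\<lambda>z. z ^ k) \<in> neil_algebra"
proof -
  have "(\<lambda>z::complex. z ^ k) = poly (monom 1 k)" by (auto simp: poly_monom)
  then show ?thesis
    using assms by (simp only: on_disk_poly_in_neil_algebra) (simp add: assms)
qed

text \<open>A polynomial approximation of \<open>f\<close> may have a linear term, but by Cauchy's estimate applied to
  the error its coefficient is no larger than the error, since \<open>f\<close> has none. Deleting the linear
  term therefore at most doubles the error.\<close>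

lemma neil_algebra_approx:
  assumes f: "f \<in> neil_algebra" and e: "e > 0"
  obtains q where "coeff q 1 = 0" "\<And>z. z \<in> cball 0 1 \<Longrightarrow> cmod (f z - poly q z) \<le> e"
proof -
  have fD: "f \<in> disk_algebra" and f1: "taylor_coeff 1 f = 0"
    using f by (auto simp: neil_algebra_iff)
  obtain p where p: "\<And>z. z \<in> cball 0 1 \<Longrightarrow> cmod (f z - poly p z) \<le> e / 2"
    using disk_algebra_approx[OF fD, of "e / 2"] e by auto
  define q where "q = p - monom (coeff p 1) 1"
  have "taylor_coeff 1 (on_disk (\<lambda>z. f z - poly p z)) = - coeff p 1"
    using f1 by (simp add: taylor_coeff_diff_poly[OF fD] del: One_nat_def)
  moreover have "cmod (taylor_coeff 1 (on_disk (\<lambda>z. f z - poly p z))) \<le> e / 2"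
    by (rule norm_taylor_coeff_le) (use p disk_algebra_diff_poly[OF fD] in auto)
  ultimately have p1: "cmod (coeff p 1) \<le> e / 2" by (simp del: One_nat_def)
  have "cmod (f z - poly q z) \<le> e" if z: "z \<in> cball 0 1" for z
  proof -
    have "f z - poly q z = (f z - poly p z) + coeff p 1 * z"
      by (simp add: q_def poly_monom)
    also have "cmod \<dots> \<le> cmod (f z - poly p z) + cmod (coeff p 1) * cmod z"
      by (metis norm_triangle_ineq norm_mult)
    also have "\<dots> \<le> e / 2 + e / 2 * 1"
      using z e by (intro add_mono mult_mono p p1) auto
    finally show ?thesis by simp
  qed
  moreover have "coeff q 1 = 0" by (simp add: q_def)
  ultimately show ?thesis using that by blast
qed

lemma neil_algebra_diff_poly:
  assumes f: "f \<in> neil_algebra" and q: "coeff q 1 = 0"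
  shows "on_disk (\<lambda>z. f z - poly q z) \<in> neil_algebra"
proof -
  have fD: "f \<in> disk_algebra" and f1: "taylor_coeff 1 f = 0"
    using f by (auto simp: neil_algebra_iff)
  show ?thesis
    using f1 q disk_algebra_diff_poly[OF fD] taylor_coeff_diff_poly[OF fD, of 1 q]
    by (simp only: neil_algebra_iff) simp
qed

section \<open>Representations of the Neil algebra\<close>

lemma bounded_unital_repD:
  assumes "bounded_unital_rep n \<pi>"
  shows "f \<in> neil_algebra \<Longrightarrow> \<pi> f \<in> carrier_mat n n"
    and "f \<in> neil_algebra \<Longrightarrow> g \<in> neil_algebra \<Longrightarrow> \<pi> (on_disk (\<lambda>z. f z + g z)) = \<pi> f + \<pi> g"
    and "f \<in> neil_algebra \<Longrightarrow> \<pi> (on_disk (\<lambda>z. c * f z)) = c \<cdot>\<^sub>m \<pi> f"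
    and "f \<in> neil_algebra \<Longrightarrow> g \<in> neil_algebra \<Longrightarrow> \<pi> (on_disk (\<lambda>z. f z * g z)) = \<pi> f * \<pi> g"
    and "\<pi> (on_disk (\<lambda>z. 1)) = 1\<^sub>m n"
    and "\<exists>C. \<forall>f\<in>neil_algebra. op_norm (\<pi> f) \<le> C * sup_norm f"
  using assms unfolding bounded_unital_rep_def by blast+

text \<open>Boundedness in the form used for limits: a pointwise bound on \<open>f\<close> controls each entry of
  \<open>\<pi> f\<close>. The constant is made nonnegative so that it can be multiplied by an upper bound for the
  supremum norm.\<close>

lemma norm_entry_rep_le:
  assumes \<pi>: "bounded_unital_rep n \<pi>"
  obtains C where "0 \<le> C"
    "\<And>f e i j. f \<in> neil_algebra \<Longrightarrow> (\<And>z. z \<in> cball 0 1 \<Longrightarrow> cmod (f z) \<le> e) \<Longrightarrow>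
       i < n \<Longrightarrow> j < n \<Longrightarrow> cmod (\<pi> f $$ (i, j)) \<le> C * e"
proof -
  obtain C where C: "\<And>f. f \<in> neil_algebra \<Longrightarrow> op_norm (\<pi> f) \<le> C * sup_norm f"
    using bounded_unital_repD(6)[OF \<pi>] by blast
  have "cmod (\<pi> f $$ (i, j)) \<le> \<bar>C\<bar> * e"
    if f: "f \<in> neil_algebra" and e: "\<And>z. z \<in> cball 0 1 \<Longrightarrow> cmod (f z) \<le> e" and "i < n" "j < n"
    for f e i j
  proof -
    have "\<pi> f \<in> carrier_mat n n"
      by (rule bounded_unital_repD(1)[OF \<pi> f])
    then have "cmod (\<pi> f $$ (i, j)) \<le> op_norm (\<pi> f)"
      using that by (intro norm_entry_le_op_norm) auto
    also have "\<dots> \<le> C * sup_norm f" using C f by blast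
    also have "\<dots> \<le> \<bar>C\<bar> * e"
    proof (rule mult_mono)
      show "sup_norm f \<le> e" by (rule sup_norm_leI) (rule e)
      have "0 \<le> cmod (f 0)" by simp
      also have "\<dots> \<le> sup_norm f"
        using f by (intro norm_le_sup_norm) (auto simp: neil_algebra_def)
      finally show "0 \<le> sup_norm f" .
    qed auto
    finally show ?thesis .
  qed
  then show ?thesis using that[of "\<bar>C\<bar>"] by auto
qed

text \<open>Every \<open>k \<noteq> 1\<close> is a sum of twos and threes: peel off \<open>z\<^sup>2\<close> until the exponent is
  \<open>0\<close>, \<open>2\<close> or \<open>3\<close>. The induction starts at \<open>4\<close> because from \<open>3\<close> one would reach the forbidden
  exponent \<open>1\<close>.\<close>

lemma bounded_unital_reps_agree_on_powers:
  assumes \<pi>: "bounded_unital_rep n \<pi>" and \<rho>: "bounded_unital_rep n \<rho>"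
    and 2: "\<rho> (on_disk (\<lambda>z. z ^ 2)) = \<pi> (on_disk (\<lambda>z. z ^ 2))"
    and 3: "\<rho> (on_disk (\<lambda>z. z ^ 3)) = \<pi> (on_disk (\<lambda>z. z ^ 3))"
    and "k \<noteq> 1"
  shows "\<rho> (on_disk (\<lambda>z. z ^ k)) = \<pi> (on_disk (\<lambda>z. z ^ k))"
  using \<open>k \<noteq> 1\<close>
proof (induction k rule: less_induct)
  case (less k)
  consider "k = 0" | "k = 2" | "k = 3" | "k \<ge> 4" using less.prems by linarith
  then show ?case
  proof cases
    case 1
    then show ?thesis
      using bounded_unital_repD(5)[OF \<pi>] bounded_unital_repD(5)[OF \<rho>] by (simp only: power_0)
  next
    case 4
    have eq: "on_disk (\<lambda>z. z ^ k) =
        on_disk (\<lambda>z. on_disk (\<lambda>z. z ^ (k - 2)) z * on_disk (\<lambda>z. z ^ 2) z)"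
    proof -
      have split: "z ^ k = z ^ (k - 2) * z ^ 2" for z :: complex
      proof -
        have "k = k - 2 + 2" using 4 by simp
        then have "z ^ k = z ^ (k - 2 + 2)" by (rule arg_cong)
        then show ?thesis by (simp only: power_add)
      qed
      show ?thesis by (intro restrict_ext) (subst split, simp)
    qed
    have mult: "\<sigma> (on_disk (\<lambda>z. z ^ k)) = \<sigma> (on_disk (\<lambda>z. z ^ (k - 2))) * \<sigma> (on_disk (\<lambda>z. z ^ 2))"
      if "bounded_unital_rep n \<sigma>" for \<sigma>
    proof -
      have "on_disk (\<lambda>z. z ^ (k - 2)) \<in> neil_algebra" "on_disk (\<lambda>z. z ^ 2) \<in> neil_algebra"
        using 4 by (auto intro!: on_disk_power_in_neil_algebra)
      then show ?thesis
        unfolding eq by (rule bounded_unital_repD(4)[OF that])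
    qed
    have "k - 2 < k" "k - 2 \<noteq> 1" using 4 by auto
    from less.IH[OF this] show ?thesis
      unfolding mult[OF \<pi>] mult[OF \<rho>] 2 by (rule arg_cong)
  qed (simp_all only: 2 3)
qed

lemma bounded_unital_reps_agree_on_polys:
  assumes \<pi>: "bounded_unital_rep n \<pi>" and \<rho>: "bounded_unital_rep n \<rho>"
    and 2: "\<rho> (on_disk (\<lambda>z. z ^ 2)) = \<pi> (on_disk (\<lambda>z. z ^ 2))"
    and 3: "\<rho> (on_disk (\<lambda>z. z ^ 3)) = \<pi> (on_disk (\<lambda>z. z ^ 3))"
    and q: "coeff q 1 = 0"
  shows "\<rho> (on_disk (poly q)) = \<pi> (on_disk (poly q))"
proof -
  \<comment> \<open>Partial sums of the monomials of \<open>q\<close>, so that the induction stays among polynomials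
    without linear term, which belong to the algebra.\<close>
  define s where "s A = (\<Sum>i\<in>A. monom (coeff q i) i)" for A
  have s1: "coeff (s A) 1 = 0" if "finite A" for A
    using that q by (induction A rule: finite_induct) (auto simp: s_def)
  have "\<rho> (on_disk (poly (s A))) = \<pi> (on_disk (poly (s A)))" if "finite A" for A
    using that
  proof (induction A rule: finite_induct)
    case empty
    have zero: "on_disk (poly (s {})) = on_disk (\<lambda>z. 0 * on_disk (\<lambda>z. z ^ 2) z)"
      by (auto simp: s_def restrict_def)
    have "\<sigma> (on_disk (poly (s {}))) = 0 \<cdot>\<^sub>m \<sigma> (on_disk (\<lambda>z. z ^ 2))"
      if "bounded_unital_rep n \<sigma>" for \<sigma>
      unfolding zero
      by (intro bounded_unital_repD(3)[OF that] on_disk_power_in_neil_algebra) simp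
    then show ?case using \<pi> \<rho> 2 by metis
  next
    case (insert k A)
    have sA: "on_disk (poly (s A)) \<in> neil_algebra"
      using insert s1 by (simp only: on_disk_poly_in_neil_algebra)
    show ?case
    proof (cases "k = 1")
      case True
      then have "s (insert k A) = s A" using insert q by (simp add: s_def)
      then show ?thesis using insert by simp
    next
      case False
      note k = on_disk_power_in_neil_algebra[OF False]
      have ck: "on_disk (\<lambda>z. coeff q k * on_disk (\<lambda>z. z ^ k) z) = on_disk (poly (monom (coeff q k) k))"
        by (auto simp: restrict_def poly_monom)
      have ckN: "on_disk (\<lambda>z. coeff q k * on_disk (\<lambda>z. z ^ k) z) \<in> neil_algebra"
        unfolding ck on_disk_poly_in_neil_algebra using False by simp
      have eq: "on_disk (poly (s (insert k A))) =
          on_disk (\<lambda>z. on_disk (\<lambda>z. coeff q k * on_disk (\<lambda>z. z ^ k) z) z + on_disk (poly (s A)) z)"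
        using insert by (auto simp: restrict_def s_def poly_monom)
      have "\<sigma> (on_disk (poly (s (insert k A)))) =
          coeff q k \<cdot>\<^sub>m \<sigma> (on_disk (\<lambda>z. z ^ k)) + \<sigma> (on_disk (poly (s A)))"
        if "bounded_unital_rep n \<sigma>" for \<sigma>
        unfolding eq bounded_unital_repD(2)[OF that ckN sA] bounded_unital_repD(3)[OF that k] ..
      then show ?thesis
        using \<pi> \<rho> insert.IH bounded_unital_reps_agree_on_powers[OF \<pi> \<rho> 2 3 False] by metis
    qed
  qed
  from this[of "{..degree q}"] show ?thesis
    by (simp add: s_def poly_as_sum_of_monoms)
qed

text \<open>Two representations that agree on a dense subspace agree: writing \<open>f = h + q\<close> with a
  polynomial \<open>q\<close> and small \<open>h\<close>, the polynomial parts cancel in \<open>\<rho> f - \<pi> f\<close>.\<close>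

theorem bounded_unital_rep_unique:
  assumes \<pi>: "bounded_unital_rep n \<pi>" and \<rho>: "bounded_unital_rep n \<rho>"
    and 2: "\<rho> (on_disk (\<lambda>z. z ^ 2)) = \<pi> (on_disk (\<lambda>z. z ^ 2))"
    and 3: "\<rho> (on_disk (\<lambda>z. z ^ 3)) = \<pi> (on_disk (\<lambda>z. z ^ 3))"
    and f: "f \<in> neil_algebra"
  shows "\<rho> f = \<pi> f"
proof -
  obtain C where C: "0 \<le> C" "\<And>f e i j. f \<in> neil_algebra \<Longrightarrow>
      (\<And>z. z \<in> cball 0 1 \<Longrightarrow> cmod (f z) \<le> e) \<Longrightarrow> i < n \<Longrightarrow> j < n \<Longrightarrow> cmod (\<pi> f $$ (i, j)) \<le> C * e"
    using norm_entry_rep_le[OF \<pi>] by blast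
  obtain D where D: "0 \<le> D" "\<And>f e i j. f \<in> neil_algebra \<Longrightarrow>
      (\<And>z. z \<in> cball 0 1 \<Longrightarrow> cmod (f z) \<le> e) \<Longrightarrow> i < n \<Longrightarrow> j < n \<Longrightarrow> cmod (\<rho> f $$ (i, j)) \<le> D * e"
    using norm_entry_rep_le[OF \<rho>] by blast
  have carrier: "\<sigma> g \<in> carrier_mat n n" if "bounded_unital_rep n \<sigma>" "g \<in> neil_algebra" for \<sigma> g
    using that by (rule bounded_unital_repD(1))
  show ?thesis
  proof (rule eq_matI)
    fix i j assume "i < dim_row (\<pi> f)" "j < dim_col (\<pi> f)"
    then have ij: "i < n" "j < n" using carrier[OF \<pi> f] by auto
    have "cmod (\<rho> f $$ (i, j) - \<pi> f $$ (i, j)) \<le> (D + C) * e" if "e > 0" for e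
    proof -
      obtain q where q: "coeff q 1 = 0" "\<And>z. z \<in> cball 0 1 \<Longrightarrow> cmod (f z - poly q z) \<le> e"
        using neil_algebra_approx[OF f \<open>e > 0\<close>] by blast
      define h where "h = on_disk (\<lambda>z. f z - poly q z)"
      have h: "h \<in> neil_algebra"
        unfolding h_def by (rule neil_algebra_diff_poly[OF f q(1)])
      have he: "cmod (h z) \<le> e" if "z \<in> cball 0 1" for z
        using that q(2) by (simp add: h_def)
      have qN: "on_disk (poly q) \<in> neil_algebra"
        using q(1) by (simp only: on_disk_poly_in_neil_algebra)
      have split: "f = on_disk (\<lambda>z. h z + on_disk (poly q) z)"
        using f extensional_arb[of f]
        by (auto simp: h_def restrict_def neil_algebra_def fun_eq_iff dest: disk_algebra_extensional)
      have "\<sigma> f = \<sigma> h + \<sigma> (on_disk (poly q))" if "bounded_unital_rep n \<sigma>" for \<sigma>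
        by (subst split) (rule bounded_unital_repD(2)[OF that h qN])
      then have split_entry: "\<sigma> f $$ (i, j) = \<sigma> h $$ (i, j) + \<sigma> (on_disk (poly q)) $$ (i, j)"
        if "bounded_unital_rep n \<sigma>" for \<sigma>
        using that ij carrier[OF that h] carrier[OF that qN] by (metis carrier_matD index_add_mat(1))
      have "\<rho> f $$ (i, j) - \<pi> f $$ (i, j) = \<rho> h $$ (i, j) - \<pi> h $$ (i, j)"
        unfolding split_entry[OF \<pi>] split_entry[OF \<rho>]
          bounded_unital_reps_agree_on_polys[OF \<pi> \<rho> 2 3 q(1)] by simp
      also have "cmod \<dots> \<le> cmod (\<rho> h $$ (i, j)) + cmod (\<pi> h $$ (i, j))"
        by (rule norm_triangle_ineq4)
      also have "\<dots> \<le> D * e + C * e"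
        by (intro add_mono C(2) D(2) h he ij)
      finally show ?thesis by (simp add: distrib_right)
    qed
    note bound = this
    have "cmod (\<rho> f $$ (i, j) - \<pi> f $$ (i, j)) \<le> 0 + e" if "e > 0" for e
    proof -
      \<comment> \<open>The added \<open>1\<close> avoids division by zero when both constants vanish.\<close>
      have "cmod (\<rho> f $$ (i, j) - \<pi> f $$ (i, j)) \<le> (D + C) * (e / (D + C + 1))"
        using C(1) D(1) that by (intro bound) simp
      also have "\<dots> \<le> e"
        using C(1) D(1) that by (simp add: field_simps)
      finally show ?thesis by simp
    qed
    then have "cmod (\<rho> f $$ (i, j) - \<pi> f $$ (i, j)) \<le> 0"
      by (rule field_le_epsilon)
    then show "\<rho> f $$ (i, j) = \<pi> f $$ (i, j)" by simp
  qed (simp_all only: carrier_matD[OF carrier[OF \<pi> f]] carrier_matD[OF carrier[OF \<rho> f]])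
qed

section \<open>The counterexample\<close>

definition shift2 :: "complex Matrix.mat" where
  "shift2 = Matrix.mat 2 2 (\<lambda>(i, j). if i = 0 \<and> j = 1 then 1 else 0)"

definition shift2_rep :: "(complex \<Rightarrow> complex) \<Rightarrow> complex Matrix.mat" where
  "shift2_rep f = taylor_coeff 0 f \<cdot>\<^sub>m 1\<^sub>m 2 + (taylor_coeff 2 f + taylor_coeff 3 f) \<cdot>\<^sub>m shift2"

lemma shift2_carrier [simp]: "shift2 \<in> carrier_mat 2 2"
  by (simp add: shift2_def)

lemma shift2_square: "shift2 * shift2 = 0\<^sub>m 2 2"
  by (intro eq_matI) (auto simp: shift2_def scalar_prod_def intro!: sum.neutral)

lemma contractive_shift2: "contractive_mat shift2"
  unfolding contractive_mat_def
proof (rule op_norm_leI)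
  fix v assume v: "v \<in> carrier_vec (dim_col shift2)" "euclid_norm v \<le> 1"
  then have d: "dim_vec v = 2" by (simp add: shift2_def)
  have "euclid_norm (shift2 *\<^sub>v v) = cmod (vec_index v 1)"
    using d by (simp add: euclid_norm_def L2_set_def shift2_def scalar_prod_def numeral_2_eq_2)
  also have "\<dots> \<le> euclid_norm v"
    using d by (intro norm_component_le_euclid_norm) simp
  finally show "euclid_norm (shift2 *\<^sub>v v) \<le> 1" using v by simp
qed

lemma shift2_rep_carrier: "shift2_rep f \<in> carrier_mat 2 2"
  by (simp add: shift2_rep_def)

lemma shift2_rep_index:
  assumes "i < 2" "j < 2"
  shows "shift2_rep f $$ (i, j) =
    (if i = j then taylor_coeff 0 f else if i < j then taylor_coeff 2 f + taylor_coeff 3 f else 0)"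
  using assms by (auto simp: shift2_rep_def shift2_def)

lemma shift2_rep_poly:
  "shift2_rep (on_disk (poly p)) = coeff p 0 \<cdot>\<^sub>m 1\<^sub>m 2 + (coeff p 2 + coeff p 3) \<cdot>\<^sub>m shift2"
  by (simp add: shift2_rep_def taylor_coeff_poly)

text \<open>In the Cauchy products for the coefficients of \<open>z\<^sup>2\<close> and \<open>z\<^sup>3\<close> every term other than the first and the
  last contains a linear coefficient, hence vanishes on the Neil algebra. What remains is the
  Leibniz rule, which is exactly what the product of two matrices \<open>a I + b E\<close> with \<open>E\<^sup>2 = 0\<close> requires.\<close>

lemma bounded_unital_rep_shift2_rep: "bounded_unital_rep 2 shift2_rep"
  unfolding bounded_unital_rep_def
proof (intro conjI ballI allI)
  fix f assume f: "f \<in> neil_algebra"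
  show "shift2_rep f \<in> carrier_mat 2 2" by (rule shift2_rep_carrier)
  have hf: "f holomorphic_on ball 0 1" and f1: "taylor_coeff 1 f = 0"
    using f by (auto simp: neil_algebra_iff disk_algebra_holomorphic)
  show "shift2_rep (on_disk (\<lambda>z. c * f z)) = c \<cdot>\<^sub>m shift2_rep f" for c
    by (intro eq_matI)
       (auto simp: shift2_rep_index taylor_coeff_cmult[OF hf] carrier_matD[OF shift2_rep_carrier]
                   distrib_left)
  fix g assume g: "g \<in> neil_algebra"
  have hg: "g holomorphic_on ball 0 1" and g1: "taylor_coeff 1 g = 0"
    using g by (auto simp: neil_algebra_iff disk_algebra_holomorphic)
  show "shift2_rep (on_disk (\<lambda>z. f z + g z)) = shift2_rep f + shift2_rep g"
    by (intro eq_matI)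
       (auto simp: shift2_rep_index taylor_coeff_add[OF hf hg] carrier_matD[OF shift2_rep_carrier])
  have m: "taylor_coeff 0 (on_disk (\<lambda>z. f z * g z)) = taylor_coeff 0 f * taylor_coeff 0 g"
    "taylor_coeff 2 (on_disk (\<lambda>z. f z * g z)) =
       taylor_coeff 0 f * taylor_coeff 2 g + taylor_coeff 2 f * taylor_coeff 0 g"
    "taylor_coeff 3 (on_disk (\<lambda>z. f z * g z)) =
       taylor_coeff 0 f * taylor_coeff 3 g + taylor_coeff 3 f * taylor_coeff 0 g"
    using f1 g1 by (simp_all add: taylor_coeff_mult[OF hf hg] eval_nat_numeral)
  show "shift2_rep (on_disk (\<lambda>z. f z * g z)) = shift2_rep f * shift2_rep g"
  proof (intro eq_matI)
    fix i j assume "i < dim_row (shift2_rep f * shift2_rep g)" "j < dim_col (shift2_rep f * shift2_rep g)"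
    then have ij: "i < 2" "j < 2" by (simp_all add: carrier_matD[OF shift2_rep_carrier])
    have "(shift2_rep f * shift2_rep g) $$ (i, j) =
        (\<Sum>k<2. shift2_rep f $$ (i, k) * shift2_rep g $$ (k, j))"
      using ij carrier_matD[OF shift2_rep_carrier] by (simp add: scalar_prod_def atLeast0LessThan)
    also have "\<dots> = shift2_rep f $$ (i, 0) * shift2_rep g $$ (0, j) +
                    shift2_rep f $$ (i, 1) * shift2_rep g $$ (1, j)"
      by (simp add: eval_nat_numeral)
    also have "\<dots> = shift2_rep (on_disk (\<lambda>z. f z * g z)) $$ (i, j)"
      using ij by (auto simp: shift2_rep_index m less_2_cases_iff algebra_simps)
    finally show "shift2_rep (on_disk (\<lambda>z. f z * g z)) $$ (i, j) = (shift2_rep f * shift2_rep g) $$ (i, j)"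
      by simp
  qed (auto simp: carrier_matD[OF shift2_rep_carrier])
next
  have "(\<lambda>z. 1) = poly [:1 :: complex:]" by auto
  then show "shift2_rep (on_disk (\<lambda>z. 1)) = 1\<^sub>m 2"
    by (simp only: shift2_rep_poly) (intro eq_matI, auto simp: shift2_def eval_nat_numeral)
next
  show "\<exists>C. \<forall>f\<in>neil_algebra. op_norm (shift2_rep f) \<le> C * sup_norm f"
  proof (intro exI[of _ 4] ballI)
    fix f assume "f \<in> neil_algebra"
    then have f: "f \<in> disk_algebra" by (simp add: neil_algebra_def)
    have c: "cmod (taylor_coeff k f) \<le> sup_norm f" for k
      by (intro norm_taylor_coeff_le norm_le_sup_norm f)
    have "op_norm (shift2_rep f) \<le> (\<Sum>i<2. \<Sum>j<2. cmod (shift2_rep f $$ (i, j)))"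
      using op_norm_le_sum[of "shift2_rep f"] by (simp add: carrier_matD[OF shift2_rep_carrier])
    also have "\<dots> = 2 * cmod (taylor_coeff 0 f) + cmod (taylor_coeff 2 f + taylor_coeff 3 f)"
      by (simp add: numeral_2_eq_2[THEN arg_cong[of _ _ lessThan]] shift2_rep_index)
    also have "\<dots> \<le> 2 * sup_norm f + (sup_norm f + sup_norm f)"
      by (intro add_mono mult_left_mono order_trans[OF norm_triangle_ineq] c) auto
    finally show "op_norm (shift2_rep f) \<le> 4 * sup_norm f" by simp
  qed
qed

text \<open>For fixed \<open>s = \<bar>z\<bar>\<^sup>2\<close> the squared modulus is a concave quadratic in \<open>Re z\<close>. Completing the square
  gives its maximum \<open>6 + 6 s + 3/2 s\<^sup>2\<close>, which increases with \<open>s\<close> and equals \<open>27/2\<close> at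
  \<open>s = 1\<close>.\<close>

lemma norm_quadratic_le:
  assumes "cmod z \<le> 1"
  shows "(cmod (2 + 2 * z - z\<^sup>2))\<^sup>2 \<le> 27 / 2"
proof -
  obtain x y where z: "z = Complex x y" by (cases z)
  define s where "s = x\<^sup>2 + y\<^sup>2"
  have s: "0 \<le> s" "s \<le> 1"
    using power_mono[OF assms, of 2] by (auto simp: s_def z cmod_power2)
  have "(cmod (2 + 2 * z - z\<^sup>2))\<^sup>2 = (2 + 2 * x - (x\<^sup>2 - y\<^sup>2))\<^sup>2 + (2 * y - 2 * x * y)\<^sup>2"
    unfolding cmod_power2 by (simp add: z Re_power2 Im_power2)
  also have "\<dots> = 6 + 6 * s + 3 / 2 * s\<^sup>2 - 8 * (x - (2 - s) / 4)\<^sup>2"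
    by (simp add: s_def power2_eq_square field_simps)
  also have "\<dots> \<le> 6 + 6 * 1 + 3 / 2 * 1\<^sup>2 - 0"
    by (intro diff_mono add_mono mult_left_mono power_mono s) auto
  finally show ?thesis by simp
qed

text \<open>The witness is \<open>2 z\<^sup>2 + 2 z\<^sup>3 - z\<^sup>4\<close>. The first two terms alone have supremum norm \<open>4\<close>, attained
  at \<open>1\<close>, equal to the norm of their image; subtracting \<open>z\<^sup>4\<close> lowers the supremum norm and leaves
  the image unchanged, because \<open>z\<^sup>4\<close> is in the kernel of the representation.\<close>

lemma not_contractive_shift2_rep: "\<not> contractive_rep shift2_rep"
proof
  assume contr: "contractive_rep shift2_rep"
  define p :: "complex poly" where "p = [:0, 0, 2, 2, -1:]"
  have p: "coeff p 0 = 0" "coeff p 1 = 0" "coeff p 2 = 2" "coeff p 3 = 2"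
    by (simp_all add: p_def eval_nat_numeral)
  have "cmod (shift2_rep (on_disk (poly p)) $$ (0, 1)) = 4"
    by (simp add: shift2_rep_index taylor_coeff_poly p)
  then have "4 \<le> op_norm (shift2_rep (on_disk (poly p)))"
    using norm_entry_le_op_norm[of 0 "shift2_rep (on_disk (poly p))" 1]
    by (simp add: carrier_matD[OF shift2_rep_carrier])
  also have "\<dots> \<le> sup_norm (on_disk (poly p))"
    using contr p(2) on_disk_poly_in_neil_algebra[of p] unfolding contractive_rep_def by blast
  also have "\<dots> \<le> sqrt (27 / 2)"
  proof (rule sup_norm_leI)
    fix z :: complex assume z: "z \<in> cball 0 1"
    then have z1: "cmod z \<le> 1" by simp
    have "poly p z = z\<^sup>2 * (2 + 2 * z - z\<^sup>2)"
      by (simp add: p_def power2_eq_square algebra_simps)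
    then have "cmod (poly p z) = (cmod z)\<^sup>2 * cmod (2 + 2 * z - z\<^sup>2)"
      by (simp add: norm_mult norm_power)
    also have "\<dots> \<le> 1 * cmod (2 + 2 * z - z\<^sup>2)"
      using z1 by (intro mult_right_mono power_le_one) auto
    also have "\<dots> \<le> sqrt (27 / 2)"
      using norm_quadratic_le[OF z1] by (simp add: real_le_rsqrt)
    finally show "cmod (on_disk (poly p) z) \<le> sqrt (27 / 2)"
      using z by simp
  qed
  also have "\<dots> < 4" by (rule real_less_lsqrt) auto
  finally show False by simp
qed

theorem corollary3p2:
  shows "\<exists>(n::nat) (X::complex Matrix.mat) (Y::complex Matrix.mat).
    X \<in> carrier_mat n n \<and> Y \<in> carrier_mat n n \<and>
    X * Y = Y * X \<and>
    contractive_mat X \<and> contractive_mat Y \<and>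
    X ^\<^sub>m 3 = Y ^\<^sub>m 2 \<and>
    (\<exists>\<pi>. bounded_unital_rep n \<pi> \<and>
         \<pi> (on_disk (\<lambda>z. z ^ 2)) = X \<and> \<pi> (on_disk (\<lambda>z. z ^ 3)) = Y \<and>
         (\<forall>\<rho>. bounded_unital_rep n \<rho> \<and>
              \<rho> (on_disk (\<lambda>z. z ^ 2)) = X \<and> \<rho> (on_disk (\<lambda>z. z ^ 3)) = Y
              \<longrightarrow> (\<forall>f\<in>neil_algebra. \<rho> f = \<pi> f)) \<and>
         \<not> contractive_rep \<pi>)"
proof -
  have power: "shift2_rep (on_disk (\<lambda>z. z ^ k)) = shift2" if "k = 2 \<or> k = 3" for k
  proof -
    have "(\<lambda>z::complex. z ^ k) = poly (monom 1 k)" by (auto simp: poly_monom)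
    then have "shift2_rep (on_disk (\<lambda>z. z ^ k)) =
        coeff (monom 1 k) 0 \<cdot>\<^sub>m 1\<^sub>m 2 + (coeff (monom 1 k) 2 + coeff (monom 1 k) 3) \<cdot>\<^sub>m shift2"
      by (simp only: shift2_rep_poly)
    also have "\<dots> = shift2" using that by (intro eq_matI) (auto simp: shift2_def)
    finally show ?thesis .
  qed
  have "shift2 ^\<^sub>m 2 = 0\<^sub>m 2 2"
    using shift2_square by (simp add: numeral_2_eq_2[THEN arg_cong[of _ _ "pow_mat shift2"]])
  moreover have "shift2 ^\<^sub>m 3 = shift2 ^\<^sub>m 2 * shift2"
    by (simp add: numeral_3_eq_3 numeral_2_eq_2)
  ultimately have cube_eq_square: "shift2 ^\<^sub>m 3 = shift2 ^\<^sub>m 2"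
    by (simp add: left_mult_zero_mat[OF shift2_carrier])
  show ?thesis
  proof (intro exI[of _ 2] exI[of _ shift2] exI[of _ shift2_rep] conjI allI impI ballI)
    fix \<rho> f
    assume "bounded_unital_rep 2 \<rho> \<and> \<rho> (on_disk (\<lambda>z. z ^ 2)) = shift2 \<and>
              \<rho> (on_disk (\<lambda>z. z ^ 3)) = shift2" "f \<in> neil_algebra"
    then show "\<rho> f = shift2_rep f"
      using bounded_unital_rep_unique[OF bounded_unital_rep_shift2_rep, of \<rho> f] power by metis
  qed (rule power contractive_shift2 bounded_unital_rep_shift2_rep
         not_contractive_shift2_rep cube_eq_square shift2_carrier refl | simp)+
qed

end
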